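(* Let $S$ be a spray on $T_0M$ and let $F$ be a Finsler structure on $M$ with metric tensor $g_{ij}=\frac12\frac{\partial^2F^2}{\partial y^i\partial y^j}$. Then $S$ is the geodesic spray of $F$ if and only if the metric tensor is covariant constant with respect to the dynamical covariant derivative $\nabla$ induced by $S$, that is, $\nabla g_{ij}=0$ on $T_0M$ for all $i,j$.
   Context: $M$ is a connected, $n$-dimensional smooth manifold with local coordinates $(x^i)$; $TM$ is its tangent bundle, $T_0M=TM\setminus\{0\}$ is the slit tangent bundle (zero section removed), with induced local coordinates $(x^i,y^i)$. Summation over repeated indices is understood. Homogeneity always means positive homogeneity in the fibre coordinates $y$. Finsler structure: a continuous positive function $F:TM\to\mathbb{R}$ (positive on $T_0M$), smooth on $T_0M$, positively homogeneous of order $1$ in the fibre coordinates, such that the metric tensor $g_{ij}(x,y)=\frac12\frac{\partial^2F^2}{\partial y^i\partial y^j}(x,y)$ is non-degenerate on $T_0M$. Spray: a vector field $S$ on $T_0M$ that is locally of the form $S=y^i\frac{\partial}{\partial x^i}-2G^i(x,y)\frac{\partial}{\partial y^i}$ with $G^i$ smooth locally defined functions on $T_0M$, homogeneous of order $2$ in $y$ (equivalently $JS=\mathcal{C}$ and $[\mathcal{C},S]=S$, where $\mathcal{C}=y^i\frac{\partial}{\partial y^i}$ and $J=\frac{\partial}{\partial y^i}\otimes dx^i$). Geodesic spray of $F$: the unique spray $S$ satisfying $S\left(\frac{\partial F^2}{\partial y^i}\right)-\frac{\partial F^2}{\partial x^i}=0$ for all $i$. Dynamical covariant derivative induced by $S$: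 put $N^i_j=\frac{\partial G^i}{\partial y^j}$. On functions $\nabla f=S(f)$, and on the components of a $(0,2)$-type tensor field on $T_0M$, $\nabla g_{ij}=S(g_{ij})-N^k_i g_{kj}-N^k_j g_{ik}$. *)

theory Defs
  imports "HOL-Analysis.Analysis"
begin

section \<open>Smooth maps between Euclidean spaces\<close>

primrec Ck_on :: "nat \<Rightarrow> 'a::real_normed_vector set \<Rightarrow> ('a \<Rightarrow> 'b::real_normed_vector) \<Rightarrow> bool" where
  "Ck_on 0 U f \<longleftrightarrow> continuous_on U f"
| "Ck_on (Suc k) U f \<longleftrightarrow>
     (\<forall>x\<in>U. f differentiable (at x)) \<and>
     (\<forall>v. Ck_on k U (\<lambda>x. frechet_derivative f (at x) v))"

text \<open>Only used for open \<open>U\<close>.\<close>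

definition smooth_on :: "'a::real_normed_vector set \<Rightarrow> ('a \<Rightarrow> 'b::real_normed_vector) \<Rightarrow> bool" where
  "smooth_on U f \<longleftrightarrow> (\<forall>k. Ck_on k U f)"


section \<open>Smooth manifolds given by an atlas\<close>

text \<open>
  A chart is a pair \<open>(U, \<phi>)\<close>; the values of \<open>\<phi>\<close> outside \<open>U\<close> are irrelevant.  The underlying set
  of a manifold is the union of the chart domains, and its topology is the one induced by the
  atlas. The charts are then homeomorphisms from open sets onto open subsets of the model space.
  The atlas need not be maximal; maximal atlases are included as a special case.
\<close>

type_synonym ('m, 'e) chart = "'m set \<times> ('m \<Rightarrow> 'e)"

definition chart_image :: "('m, 'e) chart \<Rightarrow> 'e set" where
  "chart_image c = snd c ` fst c"

definition chart_inv :: "('m, 'e) chart \<Rightarrow> 'e \<Rightarrow> 'm" where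
  "chart_inv c = inv_into (fst c) (snd c)"

definition transition :: "('m, 'e) chart \<Rightarrow> ('m, 'e) chart \<Rightarrow> 'e \<Rightarrow> 'e" where
  "transition c d = snd d \<circ> chart_inv c"

definition smooth_atlas :: "('m, 'e::euclidean_space) chart set \<Rightarrow> bool" where
  "smooth_atlas A \<longleftrightarrow>
     (\<forall>c\<in>A. inj_on (snd c) (fst c) \<and> open (chart_image c)) \<and>
     (\<forall>c\<in>A. \<forall>d\<in>A. open (snd c ` (fst c \<inter> fst d)) \<and>
        smooth_on (snd c ` (fst c \<inter> fst d)) (transition c d))"

definition points :: "('m, 'e) chart set \<Rightarrow> 'm set" where
  "points A = (\<Union>c\<in>A. fst c)"

definition atlas_open :: "('m, 'e::euclidean_space) chart set \<Rightarrow> 'm set \<Rightarrow> bool" where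
  "atlas_open A V \<longleftrightarrow> V \<subseteq> points A \<and> (\<forall>c\<in>A. open (snd c ` (fst c \<inter> V)))"

definition manifold_topology :: "('m, 'e::euclidean_space) chart set \<Rightarrow> 'm topology" where
  "manifold_topology A = topology_generated_by {V. atlas_open A V}"

definition smooth_manifold :: "('m, 'e::euclidean_space) chart set \<Rightarrow> bool" where
  "smooth_manifold A \<longleftrightarrow> smooth_atlas A \<and>
     Hausdorff_space (manifold_topology A) \<and> second_countable (manifold_topology A)"

lemma openin_manifold_topology:
  assumes "smooth_atlas A"
  shows "openin (manifold_topology A) V \<longleftrightarrow> atlas_open A V"
proof
  assume "openin (manifold_topology A) V"
  then have "generate_topology_on {V. atlas_open A V} V"
    by (simp add: manifold_topology_def openin_topology_generated_by_iff)
  then show "atlas_open A V"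
  proof induction
    case (Int a b)
    have "snd c ` (fst c \<inter> (a \<inter> b)) = snd c ` (fst c \<inter> a) \<inter> snd c ` (fst c \<inter> b)"
      if "c \<in> A" for c
      using assms that inj_on_image_Int[of "snd c" "fst c" "fst c \<inter> a" "fst c \<inter> b"]
      by (auto simp: smooth_atlas_def Int_ac)
    with Int show ?case by (auto simp: atlas_open_def)
  next
    case (UN K)
    have "snd c ` (fst c \<inter> \<Union>K) = (\<Union>k\<in>K. snd c ` (fst c \<inter> k))" for c by blast
    moreover have "open (\<Union>k\<in>K. snd c ` (fst c \<inter> k))" if "c \<in> A" for c
      using UN that by (auto simp: atlas_open_def)
    moreover have "\<Union>K \<subseteq> points A" using UN by (auto simp: atlas_open_def)
    ultimately show ?case unfolding atlas_open_def by metis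
  qed (auto simp: atlas_open_def)
next
  assume "atlas_open A V"
  then show "openin (manifold_topology A) V"
    by (simp add: manifold_topology_def topology_generated_by_Basis)
qed

definition local_rep :: "('m, 'e) chart \<Rightarrow> ('m \<Rightarrow> 'b) \<Rightarrow> 'e \<Rightarrow> 'b" where
  "local_rep c f = f \<circ> chart_inv c"

definition smooth_function :: "('m, 'e::euclidean_space) chart set \<Rightarrow> ('m \<Rightarrow> real) \<Rightarrow> bool" where
  "smooth_function A f \<longleftrightarrow> (\<forall>c\<in>A. smooth_on (chart_image c) (local_rep c f))"


section \<open>Tangent vectors and vector fields\<close>

text \<open>
  A tangent vector at \<open>p\<close> is represented by the family of its components in all charts around \<open>p\<close>,
  subject to the usual transformation law under a change of coordinates. The value \<open>0\<close> is
  prescribed for the remaining indices, so that a tangent vector is determined by its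
  components in a single chart around \<open>p\<close>.
\<close>

definition tangent_space ::
    "('m, 'e::euclidean_space) chart set \<Rightarrow> 'm \<Rightarrow> (('m, 'e) chart \<Rightarrow> 'e) set" where
  "tangent_space A p = {v.
     (\<forall>c\<in>A. \<forall>d\<in>A. p \<in> fst c \<inter> fst d \<longrightarrow>
        v d = frechet_derivative (transition c d) (at (snd c p)) (v c)) \<and>
     (\<forall>c. c \<notin> A \<or> p \<notin> fst c \<longrightarrow> v c = 0)}"

definition smooth_vector_field ::
    "('m, 'e::euclidean_space) chart set \<Rightarrow> ('m \<Rightarrow> ('m, 'e) chart \<Rightarrow> 'e) \<Rightarrow> bool" where
  "smooth_vector_field A X \<longleftrightarrow>
     (\<forall>p\<in>points A. X p \<in> tangent_space A p) \<and>
     (\<forall>c\<in>A. smooth_on (chart_image c) (local_rep c (\<lambda>p. X p c)))"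

text \<open>\<open>X(f)\<close> in the chart \<open>c\<close>, where \<open>f\<close> is a function of the coordinates.\<close>

definition vf_apply ::
    "('m, 'e::euclidean_space) chart \<Rightarrow> ('m \<Rightarrow> ('m, 'e) chart \<Rightarrow> 'e) \<Rightarrow> ('e \<Rightarrow> real) \<Rightarrow> 'e \<Rightarrow> real" where
  "vf_apply c X f z = frechet_derivative f (at z) (local_rep c (\<lambda>p. X p c) z)"


section \<open>The tangent bundle and the slit tangent bundle\<close>

type_synonym ('m, 'e) tvec = "'m \<times> (('m, 'e) chart \<Rightarrow> 'e)"

definition tangent_bundle :: "('m, 'e::euclidean_space) chart set \<Rightarrow> ('m, 'e) tvec set" where
  "tangent_bundle A = Sigma (points A) (tangent_space A)"

definition slit_tangent_bundle :: "('m, 'e::euclidean_space) chart set \<Rightarrow> ('m, 'e) tvec set" where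
  "slit_tangent_bundle A = {u \<in> tangent_bundle A. snd u \<noteq> (\<lambda>_. 0)}"

definition tangent_scale :: "real \<Rightarrow> ('m, 'e::euclidean_space) tvec \<Rightarrow> ('m, 'e) tvec" where
  "tangent_scale t u = (fst u, \<lambda>c. t *\<^sub>R snd u c)"

text \<open>The induced coordinates \<open>(x, y)\<close>.\<close>

definition induced_coords :: "('m, 'e) chart \<Rightarrow> ('m, 'e) tvec \<Rightarrow> 'e \<times> 'e" where
  "induced_coords c u = (snd c (fst u), snd u c)"

definition tangent_chart ::
    "('m, 'e::euclidean_space) chart set \<Rightarrow> ('m, 'e) chart \<Rightarrow> (('m, 'e) tvec, 'e \<times> 'e) chart" where
  "tangent_chart A c = ({u \<in> tangent_bundle A. fst u \<in> fst c}, induced_coords c)"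

definition slit_chart ::
    "('m, 'e::euclidean_space) chart set \<Rightarrow> ('m, 'e) chart \<Rightarrow> (('m, 'e) tvec, 'e \<times> 'e) chart" where
  "slit_chart A c = ({u \<in> slit_tangent_bundle A. fst u \<in> fst c}, induced_coords c)"

definition tangent_atlas ::
    "('m, 'e::euclidean_space) chart set \<Rightarrow> (('m, 'e) tvec, 'e \<times> 'e) chart set" where
  "tangent_atlas A = tangent_chart A ` A"

definition slit_atlas ::
    "('m, 'e::euclidean_space) chart set \<Rightarrow> (('m, 'e) tvec, 'e \<times> 'e) chart set" where
  "slit_atlas A = slit_chart A ` A"

text \<open>The induced coordinates range over exactly \<open>\<phi>(U) \<times> (\<real>\<^sup>n \ {0})\<close>.\<close>

lemma chart_inv_snd: "inj_on (snd c) (fst c) \<Longrightarrow> p \<in> fst c \<Longrightarrow> chart_inv c (snd c p) = p"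
  by (simp add: chart_inv_def inv_into_f_f)

lemma exists_tangent:
  assumes "smooth_atlas A" "c \<in> A" "p \<in> fst c"
  shows "\<exists>v\<in>tangent_space A p. v c = y"
proof -
  define v where "v = (\<lambda>d. if d \<in> A \<and> p \<in> fst d then frechet_derivative (transition c d) (at (snd c p)) y else 0)"
  have inj: "inj_on (snd d) (fst d)" if "d \<in> A" for d using assms that by (auto simp: smooth_atlas_def)
  have op: "open (snd d ` (fst d \<inter> fst e))" if "d \<in> A" "e \<in> A" for d e
    using assms that by (auto simp: smooth_atlas_def)
  have df: "transition d e differentiable (at (snd d p))" if "d \<in> A" "e \<in> A" "p \<in> fst d" "p \<in> fst e" for d e
  proof -
    have "Ck_on (Suc 0) (snd d ` (fst d \<inter> fst e)) (transition d e)"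
      using assms that unfolding smooth_atlas_def smooth_on_def by blast
    then show ?thesis using that by auto
  qed
  have "v c = y"
  proof -
    have "((\<lambda>x. x) has_derivative (\<lambda>x. x)) (at (snd c p))" by (rule has_derivative_ident)
    then have "(transition c c has_derivative (\<lambda>x. x)) (at (snd c p))"
      apply (rule has_derivative_transform_within_open[OF _ op[OF assms(2,2)]])
      using assms inj by (auto simp: transition_def chart_inv_snd)
    then show ?thesis using assms by (simp add: v_def frechet_derivative_at[symmetric])
  qed
  moreover have "v \<in> tangent_space A p"
  proof -
    { fix d e assume d: "d \<in> A" "e \<in> A" "p \<in> fst d" "p \<in> fst e"
      have tp: "transition c d (snd c p) = snd d p"
        using assms inj by (simp add: transition_def chart_inv_snd)
      let ?D = "frechet_derivative (transition c d) (at (snd c p))"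
      let ?E = "frechet_derivative (transition d e) (at (snd d p))"
      have "((transition d e \<circ> transition c d) has_derivative ?E \<circ> ?D) (at (snd c p))"
        using df[OF assms(2) d(1) assms(3) d(3)] df[OF d] unfolding frechet_derivative_works
        by (intro diff_chain_at) (auto simp: tp)
      moreover have "open (snd c ` (fst c \<inter> fst d))" using op assms d by auto
      ultimately have "(transition c e has_derivative ?E \<circ> ?D) (at (snd c p))"
        apply (rule has_derivative_transform_within_open)
        using assms d inj by (auto simp: transition_def chart_inv_snd)
      then have "v e = ?E (v d)" using d by (simp add: v_def frechet_derivative_at[symmetric])
    }
    then have "\<forall>d\<in>A. \<forall>e\<in>A. p \<in> fst d \<inter> fst e \<longrightarrow>
        v e = frechet_derivative (transition d e) (at (snd d p)) (v d)" by blast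
    moreover have "\<forall>d. d \<notin> A \<or> p \<notin> fst d \<longrightarrow> v d = 0" by (simp add: v_def)
    ultimately show ?thesis unfolding tangent_space_def by blast
  qed
  ultimately show ?thesis by blast
qed

lemma frechet_derivative_transition_zero: assumes "smooth_atlas A" "d \<in> A" "e \<in> A" "p \<in> fst d" "p \<in> fst e"
  shows "frechet_derivative (transition d e) (at (snd d p)) 0 = 0"
proof -
    have "Ck_on (Suc 0) (snd d ` (fst d \<inter> fst e)) (transition d e)"
      using assms unfolding smooth_atlas_def smooth_on_def by blast
    then have "transition d e differentiable (at (snd d p))" using assms by auto
    then show ?thesis by (simp add: linear_0 linear_frechet_derivative)
qed

lemma chart_image_slit_chart:
  assumes "smooth_atlas A" "c \<in> A"
  shows "chart_image (slit_chart A c) = chart_image c \<times> (- {0})"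
proof (rule set_eqI, clarify)
  fix x y
  show "((x,y) \<in> chart_image (slit_chart A c)) = ((x,y) \<in> chart_image c \<times> (- {0}))"
  proof
    assume "(x,y) \<in> chart_image (slit_chart A c)"
    then obtain p v where h: "p \<in> fst c" "v \<in> tangent_space A p" "v \<noteq> (\<lambda>_. 0)" "x = snd c p" "y = v c"
      by (auto simp: chart_image_def slit_chart_def slit_tangent_bundle_def tangent_bundle_def induced_coords_def)
    have "y \<noteq> 0"
    proof
      assume "y = 0"
      have "v d = 0" for d
      proof (cases "d \<in> A \<and> p \<in> fst d")
        case True
        then have "v d = frechet_derivative (transition c d) (at (snd c p)) (v c)"
          using h(1,2) assms(2) unfolding tangent_space_def by blast
        then show ?thesis
          using frechet_derivative_transition_zero[OF assms(1,2), of d p] True h(1,5) \<open>y = 0\<close> by simp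
      next
        case False
        then show ?thesis using h(2) unfolding tangent_space_def by blast
      qed
      then show False using h by auto
    qed
    then show "(x,y) \<in> chart_image c \<times> (- {0})" using h by (auto simp: chart_image_def)
  next
    assume "(x,y) \<in> chart_image c \<times> (- {0})"
    then obtain p where p: "p \<in> fst c" "x = snd c p" "y \<noteq> 0" by (auto simp: chart_image_def)
    obtain v where v: "v \<in> tangent_space A p" "v c = y" using exists_tangent[OF assms p(1)] by blast
    have "(p,v) \<in> fst (slit_chart A c)" using p v assms(2)
      by (auto simp: slit_chart_def slit_tangent_bundle_def tangent_bundle_def points_def)
    moreover have "snd (slit_chart A c) (p,v) = (x,y)" using p v by (simp add: slit_chart_def induced_coords_def)
    ultimately show "(x,y) \<in> chart_image (slit_chart A c)" unfolding chart_image_def by (metis image_eqI)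
  qed
qed

text \<open>Functions of the induced coordinates: the partial derivatives with respect to \<open>x\<^sup>i\<close> and \<open>y\<^sup>i\<close>.\<close>

definition Dx :: "'n::finite \<Rightarrow> ((real^'n) \<times> (real^'n) \<Rightarrow> real) \<Rightarrow> (real^'n) \<times> (real^'n) \<Rightarrow> real" where
  "Dx i f z = frechet_derivative f (at z) (axis i 1, 0)"

definition Dy :: "'n::finite \<Rightarrow> ((real^'n) \<times> (real^'n) \<Rightarrow> real) \<Rightarrow> (real^'n) \<times> (real^'n) \<Rightarrow> real" where
  "Dy i f z = frechet_derivative f (at z) (0, axis i 1)"


section \<open>Finsler structures\<close>

definition local_square ::
    "('m, real^'n) chart set \<Rightarrow> (('m, real^'n::finite) tvec \<Rightarrow> real) \<Rightarrow> ('m, real^'n) chart \<Rightarrow>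
     (real^'n) \<times> (real^'n) \<Rightarrow> real" where
  "local_square A F c = local_rep (slit_chart A c) (\<lambda>u. (F u)\<^sup>2)"

definition metric_tensor ::
    "('m, real^'n) chart set \<Rightarrow> (('m, real^'n::finite) tvec \<Rightarrow> real) \<Rightarrow> ('m, real^'n) chart \<Rightarrow>
     (real^'n) \<times> (real^'n) \<Rightarrow> real^'n^'n" where
  "metric_tensor A F c z = (\<chi> i j. 1/2 * Dy i (Dy j (local_square A F c)) z)"

definition finsler_structure ::
    "('m, real^'n::finite) chart set \<Rightarrow> (('m, real^'n) tvec \<Rightarrow> real) \<Rightarrow> bool" where
  "finsler_structure A F \<longleftrightarrow>
     continuous_map (manifold_topology (tangent_atlas A)) euclideanreal F \<and>
     (\<forall>u\<in>slit_tangent_bundle A. F u > 0) \<and>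
     smooth_function (slit_atlas A) F \<and>
     (\<forall>u\<in>tangent_bundle A. \<forall>t>0. F (tangent_scale t u) = t * F u) \<and>
     (\<forall>c\<in>A. \<forall>z\<in>chart_image (slit_chart A c). det (metric_tensor A F c z) \<noteq> 0)"


section \<open>Sprays\<close>

text \<open>\<open>G\<close> is the tuple of coefficient functions of \<open>S\<close> in the coordinates induced by \<open>c\<close>, i.e.
  the components of \<open>S\<close> are \<open>(y, - 2 G(x, y))\<close>.\<close>

definition is_spray ::
    "('m, real^'n::finite) chart set \<Rightarrow>
     (('m, real^'n) tvec \<Rightarrow> (('m, real^'n) tvec, (real^'n) \<times> (real^'n)) chart \<Rightarrow> (real^'n) \<times> (real^'n)) \<Rightarrow>
     bool" where
  "is_spray A S \<longleftrightarrow>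
     smooth_vector_field (slit_atlas A) S \<and>
     (\<forall>c\<in>A. \<exists>G :: (real^'n) \<times> (real^'n) \<Rightarrow> real^'n.
        smooth_on (chart_image (slit_chart A c)) G \<and>
        (\<forall>(x, y)\<in>chart_image (slit_chart A c). \<forall>t>0. G (x, t *\<^sub>R y) = t\<^sup>2 *\<^sub>R G (x, y)) \<and>
        (\<forall>u\<in>fst (slit_chart A c). S u (slit_chart A c) =
           (snd (induced_coords c u), - 2 *\<^sub>R G (induced_coords c u))))"

definition spray_coeff ::
    "('m, real^'n::finite) chart set \<Rightarrow>
     (('m, real^'n) tvec \<Rightarrow> (('m, real^'n) tvec, (real^'n) \<times> (real^'n)) chart \<Rightarrow> (real^'n) \<times> (real^'n)) \<Rightarrow>
     ('m, real^'n) chart \<Rightarrow> (real^'n) \<times> (real^'n) \<Rightarrow> real^'n" where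
  "spray_coeff A S c z =
     - (1/2) *\<^sub>R snd (local_rep (slit_chart A c) (\<lambda>u. S u (slit_chart A c)) z)"

text \<open>\<open>nonlinear_connection A S c i j\<close> is \<open>N\<^sup>i\<^sub>j\<close>: the first index is the upper one.\<close>

definition nonlinear_connection ::
    "('m, real^'n::finite) chart set \<Rightarrow>
     (('m, real^'n) tvec \<Rightarrow> (('m, real^'n) tvec, (real^'n) \<times> (real^'n)) chart \<Rightarrow> (real^'n) \<times> (real^'n)) \<Rightarrow>
     ('m, real^'n) chart \<Rightarrow> 'n \<Rightarrow> 'n \<Rightarrow> (real^'n) \<times> (real^'n) \<Rightarrow> real" where
  "nonlinear_connection A S c i j = Dy j (\<lambda>z. spray_coeff A S c z $ i)"

text \<open>The dynamical covariant derivative of a \<open>(0,2)\<close>-type tensor field with components \<open>h\<close> in the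
  coordinates induced by \<open>c\<close>.\<close>

definition dynamical_derivative ::
    "('m, real^'n::finite) chart set \<Rightarrow>
     (('m, real^'n) tvec \<Rightarrow> (('m, real^'n) tvec, (real^'n) \<times> (real^'n)) chart \<Rightarrow> (real^'n) \<times> (real^'n)) \<Rightarrow>
     ('m, real^'n) chart \<Rightarrow> ((real^'n) \<times> (real^'n) \<Rightarrow> real^'n^'n) \<Rightarrow> 'n \<Rightarrow> 'n \<Rightarrow>
     (real^'n) \<times> (real^'n) \<Rightarrow> real" where
  "dynamical_derivative A S c h i j z =
     vf_apply (slit_chart A c) S (\<lambda>w. h w $ i $ j) z
     - (\<Sum>k\<in>UNIV. nonlinear_connection A S c k i z * h z $ k $ j)
     - (\<Sum>k\<in>UNIV. nonlinear_connection A S c k j z * h z $ i $ k)"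

definition euler_lagrange ::
    "('m, real^'n::finite) chart set \<Rightarrow> (('m, real^'n) tvec \<Rightarrow> real) \<Rightarrow>
     (('m, real^'n) tvec \<Rightarrow> (('m, real^'n) tvec, (real^'n) \<times> (real^'n)) chart \<Rightarrow> (real^'n) \<times> (real^'n)) \<Rightarrow>
     bool" where
  "euler_lagrange A F S \<longleftrightarrow>
     (\<forall>c\<in>A. \<forall>z\<in>chart_image (slit_chart A c). \<forall>i.
        vf_apply (slit_chart A c) S (Dy i (local_square A F c)) z - Dx i (local_square A F c) z = 0)"

text \<open>Values of \<open>S\<close> outside the slit tangent bundle are irrelevant, so uniqueness is uniqueness there.\<close>

definition is_geodesic_spray ::
    "('m, real^'n::finite) chart set \<Rightarrow> (('m, real^'n) tvec \<Rightarrow> real) \<Rightarrow>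
     (('m, real^'n) tvec \<Rightarrow> (('m, real^'n) tvec, (real^'n) \<times> (real^'n)) chart \<Rightarrow> (real^'n) \<times> (real^'n)) \<Rightarrow>
     bool" where
  "is_geodesic_spray A F S \<longleftrightarrow>
     is_spray A S \<and> euler_lagrange A F S \<and>
     (\<forall>S'. is_spray A S' \<and> euler_lagrange A F S' \<longrightarrow> (\<forall>u\<in>slit_tangent_bundle A. S' u = S u))"

end

theory Submission
  imports Defs
begin

text \<open>
  Everything happens in the coordinates \<open>(x, y)\<close> induced by one chart. Write \<open>L = F\<^sup>2\<close>,
  \<open>L\<^sub>i = \<partial>L/\<partial>y\<^sup>i\<close> and \<open>L\<^sub>i\<^sub>j\<close> for the second derivatives in \<open>y\<close>, so that \<open>2 g\<^sub>i\<^sub>j = L\<^sub>i\<^sub>j\<close>, and let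
  \<open>N\<close> be the \<open>y\<close>-derivative of the spray coefficients \<open>G\<close>. Both implications rest on the formula
  (lemma \<open>Dy_spray_derivative\<close>)
  \<open>\<partial>(S f)/\<partial>y\<^sup>j = \<partial>f/\<partial>x\<^sup>j + S(\<partial>f/\<partial>y\<^sup>j) - 2 N\<^sup>k\<^sub>j \<partial>f/\<partial>y\<^sup>k\<close>.

  If \<open>S(L\<^sub>i) = \<partial>L/\<partial>x\<^sup>i\<close>, then differentiating this equation in \<open>y\<^sup>j\<close> and applying the formula to
  \<open>f = L\<^sub>i\<close> shows that \<open>S(L\<^sub>i\<^sub>j) - 2 N\<^sup>k\<^sub>j L\<^sub>k\<^sub>i\<close> is a difference of mixed derivatives
  that changes sign when \<open>i\<close> and \<open>j\<close> are exchanged. Its symmetric part is twice the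
  dynamical derivative of \<open>g\<^sub>i\<^sub>j\<close>, which therefore vanishes
  (\<open>metric_derivative_zero_if_euler_lagrange\<close>).

  Conversely, suppose that the dynamical derivative of the metric vanishes. By Euler's theorem
  on homogeneous functions, \<open>y\<^sup>j L\<^sub>i\<^sub>j = L\<^sub>i\<close>, \<open>y\<^sup>i L\<^sub>i = 2 L\<close> and \<open>y\<^sup>i N\<^sup>k\<^sub>i = 2 G\<^sup>k\<close>. Contracting the hypothesis
  with \<open>y\<^sup>j\<close> gives \<open>S(L\<^sub>i) = N\<^sup>k\<^sub>i L\<^sub>k\<close>, and contracting that with \<open>y\<^sup>i\<close> gives \<open>S(L) = 0\<close>. The formula
  for \<open>f = L\<close> now reads \<open>0 = \<partial>L/\<partial>x\<^sup>i + S(L\<^sub>i) - 2 S(L\<^sub>i)\<close>, which is the Euler--Lagrange equation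
  (\<open>euler_lagrange_if_metric_derivative_zero\<close>).

  The predicate for geodesic sprays also demands uniqueness. Two sprays solving the
  Euler--Lagrange equation have coefficients whose difference is annihilated by \<open>g\<close>; as \<open>g\<close> is
  nondegenerate, they agree in each chart (\<open>euler_lagrange_spray_unique\<close>).
\<close>

section \<open>Calculus of smooth functions\<close>

lemma Ck_on_Suc_differentiable:
  "Ck_on (Suc k) U f \<Longrightarrow> x \<in> U \<Longrightarrow> (f has_derivative frechet_derivative f (at x)) (at x)"
  unfolding Ck_on.simps frechet_derivative_works[symmetric] by blast

lemma Ck_on_Suc_derivative:
  "Ck_on (Suc k) U f \<Longrightarrow> Ck_on k U (\<lambda>x. frechet_derivative f (at x) v)"
  by simp

text \<open>
  A Frechet derivative at a point of \<open>U\<close> depends on the values near this point only. The lemma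
  serves to replace the derivative of a sum or a product by the expression from the corresponding
  rule, although the two need not agree outside \<open>U\<close>.
\<close>

lemma Ck_on_cong:
  assumes "open U" "\<And>x. x \<in> U \<Longrightarrow> f x = g x" "Ck_on k U f"
  shows "Ck_on k U g"
  using assms(2,3)
proof (induction k arbitrary: f g)
  case 0
  then show ?case by (simp cong: continuous_on_cong)
next
  case (Suc k)
  have hd: "(g has_derivative frechet_derivative f (at x)) (at x)" if "x \<in> U" for x
  proof (rule has_derivative_transform_within_open[OF _ assms(1) that])
    show "(f has_derivative frechet_derivative f (at x)) (at x)"
      by (rule Ck_on_Suc_differentiable[OF Suc.prems(2) that])
  qed (rule Suc.prems(1))
  have eq: "frechet_derivative f (at x) v = frechet_derivative g (at x) v" if "x \<in> U" for x v
    by (rule fun_cong[OF frechet_derivative_at[OF hd[OF that]]])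
  have "Ck_on k U (\<lambda>x. frechet_derivative f (at x) v)" for v
    using Suc.prems(2) by simp
  then have "Ck_on k U (\<lambda>x. frechet_derivative g (at x) v)" for v
    by (rule Suc.IH[rotated]) (rule eq)
  with hd show ?case unfolding Ck_on.simps differentiable_def by blast
qed

lemma Ck_on_Suc_imp: "Ck_on (Suc k) U f \<Longrightarrow> Ck_on k U f"
proof (induction k arbitrary: f)
  case 0
  then show ?case by (auto intro!: continuous_at_imp_continuous_on differentiable_imp_continuous_within)
next
  case (Suc k)
  then show ?case unfolding Ck_on.simps(2)[of "Suc k"] Ck_on.simps(2)[of k] by blast
qed

lemma Ck_on_add:
  assumes "open U" "Ck_on k U f" "Ck_on k U g"
  shows "Ck_on k U (\<lambda>x. f x + g x)"
  using assms(2,3)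
proof (induction k arbitrary: f g)
  case 0
  then show ?case by (auto intro: continuous_on_add)
next
  case (Suc k)
  have hd: "((\<lambda>x. f x + g x) has_derivative
      (\<lambda>v. frechet_derivative f (at x) v + frechet_derivative g (at x) v)) (at x)" if "x \<in> U" for x
    using Suc.prems that by (intro has_derivative_add Ck_on_Suc_differentiable)
  have "Ck_on k U (\<lambda>x. frechet_derivative f (at x) v + frechet_derivative g (at x) v)" for v
    using Suc.prems by (intro Suc.IH) simp_all
  then have "Ck_on k U (\<lambda>x. frechet_derivative (\<lambda>x. f x + g x) (at x) v)" for v
    by (rule Ck_on_cong[OF assms(1), rotated]) (simp add: frechet_derivative_at[OF hd, symmetric])
  with hd show ?case unfolding Ck_on.simps differentiable_def by blast
qed

lemma Ck_on_mult:
  fixes f g :: "'a::real_normed_vector \<Rightarrow> real"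
  assumes "open U" "Ck_on k U f" "Ck_on k U g"
  shows "Ck_on k U (\<lambda>x. f x * g x)"
  using assms(2,3)
proof (induction k arbitrary: f g)
  case 0
  then show ?case by (auto intro: continuous_on_mult)
next
  case (Suc k)
  have hd: "((\<lambda>x. f x * g x) has_derivative
      (\<lambda>v. f x * frechet_derivative g (at x) v + frechet_derivative f (at x) v * g x)) (at x)"
    if "x \<in> U" for x
    using Suc.prems that by (intro has_derivative_mult Ck_on_Suc_differentiable)
  have "Ck_on k U (\<lambda>x. f x * frechet_derivative g (at x) v + frechet_derivative f (at x) v * g x)" for v
    by (intro Ck_on_add assms(1) Suc.IH Suc.prems[THEN Ck_on_Suc_imp]
        Suc.prems[THEN Ck_on_Suc_derivative])
  then have "Ck_on k U (\<lambda>x. frechet_derivative (\<lambda>x. f x * g x) (at x) v)" for v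
    by (rule Ck_on_cong[OF assms(1), rotated]) (simp add: frechet_derivative_at[OF hd, symmetric])
  with hd show ?case unfolding Ck_on.simps differentiable_def by blast
qed

lemma smooth_on_cong:
  "open U \<Longrightarrow> (\<And>x. x \<in> U \<Longrightarrow> f x = g x) \<Longrightarrow> smooth_on U f \<Longrightarrow> smooth_on U g"
  unfolding smooth_on_def by (blast intro: Ck_on_cong)

lemma smooth_on_mult:
  fixes f g :: "'a::real_normed_vector \<Rightarrow> real"
  shows "open U \<Longrightarrow> smooth_on U f \<Longrightarrow> smooth_on U g \<Longrightarrow> smooth_on U (\<lambda>x. f x * g x)"
  unfolding smooth_on_def by (blast intro: Ck_on_mult)

lemma smooth_on_directional_derivative:
  "smooth_on U f \<Longrightarrow> smooth_on U (\<lambda>x. frechet_derivative f (at x) v)"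
  unfolding smooth_on_def
proof
  fix k assume "\<forall>k. Ck_on k U f"
  then have "Ck_on (Suc k) U f" ..
  then show "Ck_on k U (\<lambda>x. frechet_derivative f (at x) v)" by simp
qed

lemma smooth_on_has_derivative:
  "smooth_on U f \<Longrightarrow> x \<in> U \<Longrightarrow> (f has_derivative frechet_derivative f (at x)) (at x)"
  unfolding smooth_on_def by (blast intro: Ck_on_Suc_differentiable)

lemma smooth_on_continuous_on: "smooth_on U f \<Longrightarrow> continuous_on U f"
  unfolding smooth_on_def by (drule spec[of _ 0]) simp

text \<open>
  The mean value theorem is applied twice: first in the direction \<open>u\<close> to the difference of \<open>f\<close>
  along two parallel sides of the parallelogram, then in the direction \<open>v\<close> to the derivative of
  \<open>f\<close> along \<open>u\<close>. The left-hand side is symmetric in \<open>u\<close> and \<open>v\<close> while the right-hand side is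
  not; this asymmetry yields the equality of mixed derivatives.
\<close>

lemma second_difference_mean_value:
  fixes f :: "'a::real_normed_vector \<Rightarrow> real"
  assumes f: "smooth_on U f" and s: "s > 0"
    and sq: "\<And>a b. 0 \<le> a \<Longrightarrow> a \<le> s \<Longrightarrow> 0 \<le> b \<Longrightarrow> b \<le> s \<Longrightarrow> z + a *\<^sub>R u + b *\<^sub>R v \<in> U"
  shows "\<exists>a b. 0 \<le> a \<and> a \<le> s \<and> 0 \<le> b \<and> b \<le> s \<and>
    f (z + s *\<^sub>R u + s *\<^sub>R v) - f (z + s *\<^sub>R u) - f (z + s *\<^sub>R v) + f z =
      s\<^sup>2 * frechet_derivative (\<lambda>x. frechet_derivative f (at x) u) (at (z + a *\<^sub>R u + b *\<^sub>R v)) v"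
proof -
  let ?fu = "\<lambda>x. frechet_derivative f (at x) u"
  have along: "((\<lambda>r. h (p + r *\<^sub>R w)) has_real_derivative frechet_derivative h (at (p + r *\<^sub>R w)) w) (at r)"
    if h: "smooth_on U h" and m: "p + r *\<^sub>R w \<in> U" for h :: "'a \<Rightarrow> real" and p w r
  proof -
    note D = smooth_on_has_derivative[OF h m]
    have "((\<lambda>r. p + r *\<^sub>R w) has_derivative (\<lambda>t. t *\<^sub>R w)) (at r)"
      by (auto intro!: derivative_eq_intros)
    from diff_chain_at[OF this D]
    have "((\<lambda>r. h (p + r *\<^sub>R w)) has_derivative
        (\<lambda>t. frechet_derivative h (at (p + r *\<^sub>R w)) (t *\<^sub>R w))) (at r)"
      by (simp add: o_def)
    moreover have "frechet_derivative h (at (p + r *\<^sub>R w)) (t *\<^sub>R w) =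
        frechet_derivative h (at (p + r *\<^sub>R w)) w * t" for t
      using linear_cmul[OF has_derivative_linear[OF D], of t w] by simp
    ultimately show ?thesis by (simp only: has_field_derivative_def)
  qed
  have "\<exists>a. 0 < a \<and> a < s \<and>
      (f (z + s *\<^sub>R v + s *\<^sub>R u) - f (z + s *\<^sub>R u)) - (f (z + s *\<^sub>R v + 0 *\<^sub>R u) - f (z + 0 *\<^sub>R u)) =
        (s - 0) * (?fu (z + s *\<^sub>R v + a *\<^sub>R u) - ?fu (z + a *\<^sub>R u))"
  proof (rule MVT2[OF s, of "\<lambda>r. f (z + s *\<^sub>R v + r *\<^sub>R u) - f (z + r *\<^sub>R u)"])
    fix r :: real assume r: "0 \<le> r" "r \<le> s"
    have "z + s *\<^sub>R v + r *\<^sub>R u \<in> U" "z + r *\<^sub>R u \<in> U"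
      using sq[of r s] sq[of r 0] r s by (auto simp: add_ac)
    then show "((\<lambda>r. f (z + s *\<^sub>R v + r *\<^sub>R u) - f (z + r *\<^sub>R u)) has_real_derivative
        ?fu (z + s *\<^sub>R v + r *\<^sub>R u) - ?fu (z + r *\<^sub>R u)) (at r)"
      by (intro DERIV_diff along f)
  qed
  then obtain a where a: "0 < a" "a < s" and
    1: "f (z + s *\<^sub>R u + s *\<^sub>R v) - f (z + s *\<^sub>R u) - f (z + s *\<^sub>R v) + f z =
      s * (?fu (z + a *\<^sub>R u + s *\<^sub>R v) - ?fu (z + a *\<^sub>R u))" by (auto simp: algebra_simps)
  have "\<exists>b. 0 < b \<and> b < s \<and> ?fu (z + a *\<^sub>R u + s *\<^sub>R v) - ?fu (z + a *\<^sub>R u + 0 *\<^sub>R v) =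
      (s - 0) * frechet_derivative ?fu (at (z + a *\<^sub>R u + b *\<^sub>R v)) v"
    using a by (intro MVT2[OF s] along smooth_on_directional_derivative f sq) auto
  then obtain b where b: "0 < b" "b < s" and
    2: "?fu (z + a *\<^sub>R u + s *\<^sub>R v) - ?fu (z + a *\<^sub>R u) =
      s * frechet_derivative ?fu (at (z + a *\<^sub>R u + b *\<^sub>R v)) v" by auto
  show ?thesis
    using a b by (intro exI[of _ a] exI[of _ b]) (simp add: 1 2 power2_eq_square)
qed

text \<open>
  The second difference over a small parallelogram at \<open>z\<close> is \<open>s\<^sup>2\<close> times either mixed
  derivative, each taken at some point of the parallelogram. If the mixed derivatives differed at
  \<open>z\<close>, then by continuity their values on a small parallelogram could not meet.
\<close>

lemma smooth_on_mixed_derivatives_commute: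
  fixes f :: "'a::real_normed_vector \<Rightarrow> real"
  assumes "open U" "smooth_on U f" "z \<in> U"
  shows "frechet_derivative (\<lambda>x. frechet_derivative f (at x) u) (at z) v =
    frechet_derivative (\<lambda>x. frechet_derivative f (at x) v) (at z) u" (is "?A z = ?B z")
proof (rule ccontr)
  assume ne: "?A z \<noteq> ?B z"
  define e where "e = \<bar>?A z - ?B z\<bar> / 2"
  have e: "e > 0" using ne by (simp add: e_def)
  have nhds: "\<exists>d>0. \<forall>x. dist x z < d \<longrightarrow> x \<in> U \<and> \<bar>h x - h z\<bar> < e"
    if "smooth_on U h" for h :: "'a \<Rightarrow> real"
  proof -
    have "isCont h z"
      using smooth_on_continuous_on[OF that] assms by (simp add: continuous_on_eq_continuous_at)
    with e obtain d1 where "d1 > 0" "\<forall>x. dist x z < d1 \<longrightarrow> \<bar>h x - h z\<bar> < e"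
      by (auto simp: continuous_at_eps_delta dist_real_def)
    moreover obtain d2 where "d2 > 0" "\<forall>x. dist x z < d2 \<longrightarrow> x \<in> U"
      using assms by (auto simp: open_dist)
    ultimately show ?thesis by (intro exI[of _ "min d1 d2"]) auto
  qed
  obtain dA where dA: "dA > 0" "\<And>x. dist x z < dA \<Longrightarrow> x \<in> U \<and> \<bar>?A x - ?A z\<bar> < e"
    using nhds[of ?A] assms by (auto intro!: smooth_on_directional_derivative)
  obtain dB where dB: "dB > 0" "\<And>x. dist x z < dB \<Longrightarrow> x \<in> U \<and> \<bar>?B x - ?B z\<bar> < e"
    using nhds[of ?B] assms by (auto intro!: smooth_on_directional_derivative)
  define d where "d = min dA dB"
  have d: "d > 0" using dA dB by (simp add: d_def)
  \<comment> \<open>the side is chosen such that the parallelogram lies in the ball of radius \<open>d\<close> about \<open>z\<close>; the summand \<open>1\<close> keeps the denominator positive\<close>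
  define s where "s = d / (2 * (norm u + norm v + 1))"
  have s: "s > 0" using d by (simp add: s_def pos_less_divide_eq add_nonneg_pos)
  have near: "dist (z + a *\<^sub>R u + b *\<^sub>R v) z < d" if "0 \<le> a" "a \<le> s" "0 \<le> b" "b \<le> s" for a b
  proof -
    have "norm (a *\<^sub>R u + b *\<^sub>R v) \<le> a * norm u + b * norm v"
      using norm_triangle_ineq[of "a *\<^sub>R u" "b *\<^sub>R v"] that by simp
    also have "\<dots> \<le> s * norm u + s * norm v" using that by (intro add_mono mult_right_mono) auto
    also have "\<dots> \<le> s * (norm u + norm v + 1)" using s by (simp add: algebra_simps)
    also have "\<dots> = d / 2"
      using add_nonneg_pos[of "norm u + norm v" 1] by (simp add: s_def field_simps)
    also have "\<dots> < d" using d by simp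
    finally show ?thesis by (simp add: dist_norm add.assoc)
  qed
  have near': "dist (z + a *\<^sub>R v + b *\<^sub>R u) z < d" if "0 \<le> a" "a \<le> s" "0 \<le> b" "b \<le> s" for a b
    using near[of b a] that by (simp add: add_ac)
  have inU: "x \<in> U" if "dist x z < d" for x using dA(2)[of x] that by (simp add: d_def)
  define D where "D = f (z + s *\<^sub>R u + s *\<^sub>R v) - f (z + s *\<^sub>R u) - f (z + s *\<^sub>R v) + f z"
  obtain a b where ab: "0 \<le> a" "a \<le> s" "0 \<le> b" "b \<le> s" "D = s\<^sup>2 * ?A (z + a *\<^sub>R u + b *\<^sub>R v)"
    using second_difference_mean_value[OF assms(2) s, of z u v] inU near unfolding D_def by blast
  have "D = f (z + s *\<^sub>R v + s *\<^sub>R u) - f (z + s *\<^sub>R v) - f (z + s *\<^sub>R u) + f z"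
    by (simp add: D_def add_ac)
  then obtain a' b' where ab': "0 \<le> a'" "a' \<le> s" "0 \<le> b'" "b' \<le> s" "D = s\<^sup>2 * ?B (z + a' *\<^sub>R v + b' *\<^sub>R u)"
    using second_difference_mean_value[OF assms(2) s, of z v u] inU near' by metis
  have "?A (z + a *\<^sub>R u + b *\<^sub>R v) = ?B (z + a' *\<^sub>R v + b' *\<^sub>R u)" using ab(5) ab'(5) s by simp
  moreover have "\<bar>?A (z + a *\<^sub>R u + b *\<^sub>R v) - ?A z\<bar> < e"
    using dA(2) near[OF ab(1-4)] by (simp add: d_def)
  moreover have "\<bar>?B (z + a' *\<^sub>R v + b' *\<^sub>R u) - ?B z\<bar> < e"
    using dB(2) near'[OF ab'(1-4)] by (simp add: d_def)
  ultimately show False unfolding e_def by argo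
qed


section \<open>Sprays in induced coordinates\<close>

lemma smooth_on_Dx: "smooth_on U f \<Longrightarrow> smooth_on U (Dx i f)"
  unfolding Dx_def[abs_def] by (rule smooth_on_directional_derivative)

lemma smooth_on_Dy: "smooth_on U f \<Longrightarrow> smooth_on U (Dy i f)"
  unfolding Dy_def[abs_def] by (rule smooth_on_directional_derivative)

lemma Dx_Dy_commute:
  "open U \<Longrightarrow> smooth_on U f \<Longrightarrow> z \<in> U \<Longrightarrow> Dy j (Dx i f) z = Dx i (Dy j f) z"
  unfolding Dx_def[abs_def] Dy_def[abs_def] by (rule smooth_on_mixed_derivatives_commute)

lemma Dy_Dy_commute:
  "open U \<Longrightarrow> smooth_on U f \<Longrightarrow> z \<in> U \<Longrightarrow> Dy j (Dy i f) z = Dy i (Dy j f) z"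
  unfolding Dy_def[abs_def] by (rule smooth_on_mixed_derivatives_commute)

text \<open>
  The action on functions of the vector field with components \<open>(y, - 2 G)\<close>.
\<close>

definition spray_derivative ::
    "((real^'n) \<times> (real^'n) \<Rightarrow> real^'n::finite) \<Rightarrow> ((real^'n) \<times> (real^'n) \<Rightarrow> real) \<Rightarrow>
     (real^'n) \<times> (real^'n) \<Rightarrow> real" where
  "spray_derivative G f z = frechet_derivative f (at z) (snd z, - 2 *\<^sub>R G z)"

lemma frechet_derivative_eq_sum_Dx_Dy:
  fixes f :: "(real^'n::finite) \<times> (real^'n) \<Rightarrow> real"
  assumes "f differentiable (at z)"
  shows "frechet_derivative f (at z) (a, b) =
    (\<Sum>k\<in>UNIV. a $ k * Dx k f z) + (\<Sum>k\<in>UNIV. b $ k * Dy k f z)"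
proof -
  interpret linear "frechet_derivative f (at z)"
    using assms by (rule linear_frechet_derivative)
  have "(a, b) = (\<Sum>k\<in>UNIV. a $ k *\<^sub>R (axis k 1, 0)) + (\<Sum>k\<in>UNIV. b $ k *\<^sub>R (0, axis k 1))"
    using basis_expansion[of a] basis_expansion[of b]
    by (simp add: prod_eq_iff fst_sum snd_sum scalar_mult_eq_scaleR)
  then show ?thesis by (simp add: add sum scale Dx_def Dy_def del: scaleR_Pair)
qed

lemma spray_derivative_eq_sum:
  assumes "smooth_on U f" "z \<in> U"
  shows "spray_derivative G f z =
    (\<Sum>k\<in>UNIV. snd z $ k * Dx k f z) - 2 * (\<Sum>k\<in>UNIV. G z $ k * Dy k f z)"
proof -
  have "f differentiable (at z)" using smooth_on_has_derivative[OF assms] by (rule differentiableI)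
  then show ?thesis
    by (simp add: spray_derivative_def frechet_derivative_eq_sum_Dx_Dy sum_distrib_left
        sum_negf mult.assoc)
qed

lemma Dy_eqI: "(f has_derivative f') (at z) \<Longrightarrow> f' (0, axis j 1) = d \<Longrightarrow> Dy j f z = d"
  unfolding Dy_def using frechet_derivative_at[of f f' z] by simp

lemma Dy_cong:
  assumes "open U" "z \<in> U" "smooth_on U f" "\<And>w. w \<in> U \<Longrightarrow> f w = g w"
  shows "Dy j g z = Dy j f z"
  by (rule Dy_eqI[OF has_derivative_transform_within_open[OF smooth_on_has_derivative[OF assms(3,2)] assms(1,2,4)]])
    (simp_all add: Dy_def)

lemma spray_derivative_eqI:
  "(f has_derivative f') (at z) \<Longrightarrow> f' (snd z, - 2 *\<^sub>R G z) = d \<Longrightarrow> spray_derivative G f z = d"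
  unfolding spray_derivative_def using frechet_derivative_at[of f f' z] by simp

lemma smooth_on_component_has_derivative:
  fixes G :: "'a::real_normed_vector \<Rightarrow> real^'n::finite"
  assumes "smooth_on U G" "z \<in> U"
  shows "((\<lambda>w. G w $ k) has_derivative frechet_derivative (\<lambda>w. G w $ k) (at z)) (at z)"
proof -
  have "((\<lambda>w. G w $ k) has_derivative (\<lambda>v. frechet_derivative G (at z) v $ k)) (at z)"
    by (rule bounded_linear.has_derivative[OF bounded_linear_vec_nth smooth_on_has_derivative[OF assms]])
  then show ?thesis using frechet_derivative_at by metis
qed

text \<open>
  Differentiate \<open>y\<^sup>k \<partial>f/\<partial>x\<^sup>k - 2 G\<^sup>k \<partial>f/\<partial>y\<^sup>k\<close> by the product rule and exchange the order of the second
  derivatives. The coefficient \<open>y\<^sup>k\<close> contributes \<open>\<partial>f/\<partial>x\<^sup>j\<close> and the coefficient \<open>G\<^sup>k\<close> contributes the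
  term with \<open>N\<^sup>k\<^sub>j\<close>.
\<close>

lemma Dy_spray_derivative:
  assumes "open U" "smooth_on U f" "smooth_on U G" "z \<in> U"
  shows "Dy j (spray_derivative G f) z = Dx j f z + spray_derivative G (Dy j f) z
    - 2 * (\<Sum>k\<in>UNIV. Dy j (\<lambda>w. G w $ k) z * Dy k f z)"
proof -
  let ?h = "\<lambda>w. (\<Sum>k\<in>UNIV. snd w $ k * Dx k f w) - 2 * (\<Sum>k\<in>UNIV. G w $ k * Dy k f w)"
  let ?D = "\<lambda>f. frechet_derivative f (at z)"
  have "(?h has_derivative (\<lambda>v.
      (\<Sum>k\<in>UNIV. snd z $ k * ?D (Dx k f) v + snd v $ k * Dx k f z)
      - 2 * (\<Sum>k\<in>UNIV. G z $ k * ?D (Dy k f) v + ?D (\<lambda>w. G w $ k) v * Dy k f z))) (at z)"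
    by (intro has_derivative_diff has_derivative_sum has_derivative_mult has_derivative_mult_right
        bounded_linear.has_derivative[OF bounded_linear_vec_nth] has_derivative_snd has_derivative_ident
        smooth_on_has_derivative[OF smooth_on_Dx[OF assms(2)] assms(4)]
        smooth_on_has_derivative[OF smooth_on_Dy[OF assms(2)] assms(4)]
        smooth_on_component_has_derivative[OF assms(3,4)])
  then have "(spray_derivative G f has_derivative (\<lambda>v.
      (\<Sum>k\<in>UNIV. snd z $ k * ?D (Dx k f) v + snd v $ k * Dx k f z)
      - 2 * (\<Sum>k\<in>UNIV. G z $ k * ?D (Dy k f) v + ?D (\<lambda>w. G w $ k) v * Dy k f z))) (at z)"
    by (rule has_derivative_transform_within_open[OF _ assms(1,4)])
      (simp add: spray_derivative_eq_sum[OF assms(2)])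
  moreover have "?D (Dx k f) (0, axis j 1) = Dx k (Dy j f) z" "?D (Dy k f) (0, axis j 1) = Dy k (Dy j f) z"
    "?D (\<lambda>w. G w $ k) (0, axis j 1) = Dy j (\<lambda>w. G w $ k) z" for k
    using Dx_Dy_commute[OF assms(1,2,4)] Dy_Dy_commute[OF assms(1,2,4)] by (simp_all add: Dy_def)
  moreover have "(\<Sum>k\<in>UNIV. axis j 1 $ k * Dx k f z) = Dx j f z"
    by (simp add: axis_def if_distrib[of "\<lambda>x. x * _"] cong: if_cong)
  ultimately show ?thesis
    by (intro Dy_eqI) (auto simp: spray_derivative_eq_sum[OF smooth_on_Dy[OF assms(2)] assms(4)]
        sum.distrib algebra_simps)
qed

text \<open>
  Euler's theorem in the fibre variable, by comparing two derivatives at \<open>t = 1\<close>: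
  that of \<open>t \<mapsto> f (x, t y)\<close> by the chain rule, and that of \<open>t \<mapsto> t\<^sup>m f (x, y)\<close>.
\<close>

lemma euler_homogeneous:
  fixes f :: "(real^'n::finite) \<times> (real^'n) \<Rightarrow> real"
  assumes "f differentiable (at (x, y))" "\<And>t. t > 0 \<Longrightarrow> f (x, t *\<^sub>R y) = t ^ m * f (x, y)"
  shows "(\<Sum>k\<in>UNIV. y $ k * Dy k f (x, y)) = real m * f (x, y)"
proof -
  have "((\<lambda>t. (x, t *\<^sub>R y)) has_derivative (\<lambda>t. (0, t *\<^sub>R y))) (at (1::real))"
    by (auto intro!: derivative_eq_intros)
  moreover have "(f has_derivative frechet_derivative f (at (x, y))) (at (x, 1 *\<^sub>R y))"
    using assms(1) by (simp add: frechet_derivative_works)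
  ultimately have "((\<lambda>t. f (x, t *\<^sub>R y)) has_derivative (\<lambda>t. frechet_derivative f (at (x, y)) (0, t *\<^sub>R y))) (at 1)"
    using diff_chain_at[of "\<lambda>t. (x, t *\<^sub>R y)" _ 1 f] by (simp add: o_def)
  moreover have "((\<lambda>t. f (x, t *\<^sub>R y)) has_derivative (\<lambda>t. real m * t * f (x, y))) (at 1)"
  proof (rule has_derivative_transform_within_open[of "\<lambda>t. t ^ m * f (x, y)" _ _ _ "{0<..}"])
    show "((\<lambda>t. t ^ m * f (x, y)) has_derivative (\<lambda>t. real m * t * f (x, y))) (at 1)"
      by (auto intro!: derivative_eq_intros)
  qed (use assms(2) in auto)
  ultimately have "(\<lambda>t. frechet_derivative f (at (x, y)) (0, t *\<^sub>R y)) = (\<lambda>t. real m * t * f (x, y))"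
    by (rule has_derivative_unique)
  from fun_cong[OF this, of 1] have "frechet_derivative f (at (x, y)) (0, y) = real m * f (x, y)"
    by simp
  then show ?thesis by (simp add: frechet_derivative_eq_sum_Dx_Dy[OF assms(1)])
qed

text \<open>
  The dynamical derivative of the fibre Hessian \<open>g\<^sub>i\<^sub>j = 1/2 L\<^sub>i\<^sub>j\<close>, for a spray that is given by its
  coefficients \<open>G\<close> on an open set of coordinates.
\<close>

definition metric_derivative ::
    "((real^'n) \<times> (real^'n) \<Rightarrow> real^'n::finite) \<Rightarrow> ((real^'n) \<times> (real^'n) \<Rightarrow> real) \<Rightarrow>
     'n \<Rightarrow> 'n \<Rightarrow> (real^'n) \<times> (real^'n) \<Rightarrow> real" where
  "metric_derivative G L i j z =
     spray_derivative G (\<lambda>w. 1/2 * Dy i (Dy j L) w) z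
     - (\<Sum>k\<in>UNIV. Dy i (\<lambda>w. G w $ k) z * (1/2 * Dy k (Dy j L) z))
     - (\<Sum>k\<in>UNIV. Dy j (\<lambda>w. G w $ k) z * (1/2 * Dy i (Dy k L) z))"

lemma spray_derivative_half:
  assumes "smooth_on U f" "z \<in> U"
  shows "spray_derivative G (\<lambda>w. 1/2 * f w) z = 1/2 * spray_derivative G f z"
  by (rule spray_derivative_eqI[OF has_derivative_mult_right[OF smooth_on_has_derivative[OF assms]]])
    (simp add: spray_derivative_def)

lemma metric_derivative_eq_0_iff:
  assumes "open U" "smooth_on U L" "z \<in> U"
  shows "metric_derivative G L i j z = 0 \<longleftrightarrow>
    spray_derivative G (Dy i (Dy j L)) z =
      (\<Sum>k\<in>UNIV. Dy i (\<lambda>w. G w $ k) z * Dy k (Dy j L) z)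
      + (\<Sum>k\<in>UNIV. Dy j (\<lambda>w. G w $ k) z * Dy k (Dy i L) z)"
  using Dy_Dy_commute[OF assms, of i]
  unfolding metric_derivative_def
    spray_derivative_half[OF smooth_on_Dy[OF smooth_on_Dy[OF assms(2)]] assms(3)]
  by (auto simp: sum_divide_distrib[symmetric])

text \<open>
  The \<open>y\<^sup>j\<close>-derivative of the equation for \<open>L\<^sub>i\<close> and the \<open>y\<^sup>i\<close>-derivative of the equation for \<open>L\<^sub>j\<close>
  contain the same two mixed derivatives of \<open>L\<close> with opposite signs. Adding them leaves only
  terms of the dynamical derivative.
\<close>

lemma metric_derivative_zero_if_euler_lagrange:
  assumes "open U" "smooth_on U L" "smooth_on U G" "z \<in> U"
    and EL: "\<And>w i. w \<in> U \<Longrightarrow> spray_derivative G (Dy i L) w = Dx i L w"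
  shows "metric_derivative G L i j z = 0"
proof -
  have E: "Dy j (Dx i L) z = Dx j (Dy i L) z + spray_derivative G (Dy j (Dy i L)) z
    - 2 * (\<Sum>k\<in>UNIV. Dy j (\<lambda>w. G w $ k) z * Dy k (Dy i L) z)" for i j
  proof -
    have "Dy j (spray_derivative G (Dy i L)) z = Dy j (Dx i L) z"
      using EL by (intro Dy_cong[OF assms(1,4) smooth_on_Dx[OF assms(2)]]) simp
    then show ?thesis
      using Dy_spray_derivative[OF assms(1) smooth_on_Dy[OF assms(2)] assms(3,4), of j i] by simp
  qed
  have comm: "spray_derivative G (Dy j (Dy i L)) z = spray_derivative G (Dy i (Dy j L)) z"
  proof (rule spray_derivative_eqI)
    show "(Dy j (Dy i L) has_derivative frechet_derivative (Dy i (Dy j L)) (at z)) (at z)"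
      by (rule has_derivative_transform_within_open[OF smooth_on_has_derivative[OF _ assms(4)] assms(1,4)])
        (auto intro: smooth_on_Dy assms(2) Dy_Dy_commute[OF assms(1,2)])
  qed (simp add: spray_derivative_def)
  show ?thesis
    unfolding metric_derivative_eq_0_iff[OF assms(1,2,4)]
    using E[of i j] E[of j i] comm Dx_Dy_commute[OF assms(1,2,4)] by simp
qed

text \<open>
  The homogeneity of \<open>L\<close> and \<open>G\<close>, both of order \<open>2\<close>, enters through Euler's identities
  \<open>EL\<close> and \<open>EG\<close>. They allow one to recover first \<open>S(L\<^sub>i)\<close> and then \<open>S(L)\<close> from \<open>S(g\<^sub>i\<^sub>j)\<close>.
\<close>

lemma euler_lagrange_if_metric_derivative_zero:
  assumes "open U" "smooth_on U L" "smooth_on U G"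
    and EL: "\<And>w. w \<in> U \<Longrightarrow> (\<Sum>k\<in>UNIV. snd w $ k * Dy k L w) = 2 * L w"
    and EG: "\<And>w k. w \<in> U \<Longrightarrow> (\<Sum>i\<in>UNIV. snd w $ i * Dy i (\<lambda>w. G w $ k) w) = 2 * G w $ k"
    and mz: "\<And>w i j. w \<in> U \<Longrightarrow> metric_derivative G L i j w = 0"
    and z: "z \<in> U"
  shows "spray_derivative G (Dy i L) z = Dx i L z"
proof -
  let ?D = "\<lambda>w f. frechet_derivative f (at w)"
  let ?N = "\<lambda>w k i. Dy i (\<lambda>w. G w $ k) w"
  have prod: "((\<lambda>w. \<Sum>k\<in>UNIV. snd w $ k * f k w) has_derivative
      (\<lambda>v. \<Sum>k\<in>UNIV. snd w $ k * ?D w (f k) v + snd v $ k * f k w)) (at w)"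
    if "w \<in> U" "\<And>k. smooth_on U (f k)" for w and f :: "'a \<Rightarrow> (real^'a) \<times> (real^'a) \<Rightarrow> real"
    using that
    by (intro has_derivative_sum has_derivative_mult smooth_on_has_derivative
        bounded_linear.has_derivative[OF bounded_linear_vec_nth] has_derivative_snd has_derivative_ident)
  note sm = assms(2) smooth_on_Dy[OF assms(2)] smooth_on_Dy[OF smooth_on_Dy[OF assms(2)]]
  note comm = Dy_Dy_commute[OF assms(1,2)]
  \<comment> \<open>derivative of Euler's identity for \<open>L\<close>: the function \<open>L\<^sub>i\<close> is homogeneous of order \<open>1\<close>\<close>
  have Eg: "(\<Sum>k\<in>UNIV. snd w $ k * Dy i (Dy k L) w) = Dy i L w" if w: "w \<in> U" for w i
  proof -
    have "((\<lambda>w. 2 * L w) has_derivative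
        (\<lambda>v. \<Sum>k\<in>UNIV. snd w $ k * ?D w (Dy k L) v + snd v $ k * Dy k L w)) (at w)"
      by (rule has_derivative_transform_within_open[OF prod[OF w] assms(1) w]) (auto intro: sm EL)
    moreover have "((\<lambda>w. 2 * L w) has_derivative (\<lambda>v. 2 * ?D w L v)) (at w)"
      by (intro has_derivative_mult_right smooth_on_has_derivative[OF sm(1) w])
    ultimately have "(\<lambda>v. \<Sum>k\<in>UNIV. snd w $ k * ?D w (Dy k L) v + snd v $ k * Dy k L w) = (\<lambda>v. 2 * ?D w L v)"
      by (rule has_derivative_unique)
    from fun_cong[OF this, of "(0, axis i 1)"]
    have "(\<Sum>k\<in>UNIV. snd w $ k * Dy i (Dy k L) w) + (\<Sum>k\<in>UNIV. axis i 1 $ k * Dy k L w) = 2 * Dy i L w"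
      by (simp add: Dy_def[abs_def] sum.distrib)
    then show ?thesis by (simp add: axis_def if_distrib[of "\<lambda>x. x * _"] cong: if_cong)
  qed
  \<comment> \<open>apply \<open>S\<close> to \<open>y\<^sup>k L\<^sub>i\<^sub>k = L\<^sub>i\<close>; of the two connection terms, the one contracted in its lower index becomes \<open>2 G\<^sup>l L\<^sub>i\<^sub>l\<close> and cancels \<open>S(y\<^sup>k) L\<^sub>i\<^sub>k\<close>\<close>
  have SLi: "spray_derivative G (Dy i L) w = (\<Sum>k\<in>UNIV. ?N w k i * Dy k L w)" if w: "w \<in> U" for w i
  proof -
    have "(Dy i L has_derivative
        (\<lambda>v. \<Sum>k\<in>UNIV. snd w $ k * ?D w (Dy i (Dy k L)) v + snd v $ k * Dy i (Dy k L) w)) (at w)"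
      by (rule has_derivative_transform_within_open[OF prod[OF w] assms(1) w]) (auto intro: sm Eg)
    then have "spray_derivative G (Dy i L) w =
        (\<Sum>k\<in>UNIV. snd w $ k * spray_derivative G (Dy i (Dy k L)) w)
        - 2 * (\<Sum>k\<in>UNIV. G w $ k * Dy i (Dy k L) w)"
      by (rule spray_derivative_eqI) (simp add: spray_derivative_def sum.distrib sum_subtractf sum_distrib_left mult_ac)
    also have "(\<Sum>k\<in>UNIV. snd w $ k * spray_derivative G (Dy i (Dy k L)) w) =
        (\<Sum>k\<in>UNIV. snd w $ k * ((\<Sum>l\<in>UNIV. ?N w l i * Dy l (Dy k L) w) + (\<Sum>l\<in>UNIV. ?N w l k * Dy l (Dy i L) w)))"
      using mz[OF w] unfolding metric_derivative_eq_0_iff[OF assms(1,2) w] by simp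
    also have "\<dots> = (\<Sum>l\<in>UNIV. ?N w l i * (\<Sum>k\<in>UNIV. snd w $ k * Dy l (Dy k L) w))
        + (\<Sum>l\<in>UNIV. (\<Sum>k\<in>UNIV. snd w $ k * ?N w l k) * Dy l (Dy i L) w)"
      unfolding distrib_left sum.distrib sum_distrib_left sum_distrib_right
      by (intro arg_cong2[of _ _ _ _ "(+)"]; subst sum.swap) (simp_all add: mult_ac)
    also have "\<dots> = (\<Sum>l\<in>UNIV. ?N w l i * Dy l L w) + 2 * (\<Sum>l\<in>UNIV. G w $ l * Dy i (Dy l L) w)"
      using comm[OF w, of _ i] by (simp add: Eg[OF w] EG[OF w] sum_distrib_left mult_ac)
    finally show ?thesis by simp
  qed
  \<comment> \<open>apply \<open>S\<close> to \<open>y\<^sup>k L\<^sub>k = 2 L\<close>; the same cancellation now leaves nothing\<close>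
  have SL: "spray_derivative G L w = 0" if w: "w \<in> U" for w
  proof -
    have "((\<lambda>w. 2 * L w) has_derivative
        (\<lambda>v. \<Sum>k\<in>UNIV. snd w $ k * ?D w (Dy k L) v + snd v $ k * Dy k L w)) (at w)"
      by (rule has_derivative_transform_within_open[OF prod[OF w] assms(1) w]) (auto intro: sm EL)
    then have "spray_derivative G (\<lambda>w. 2 * L w) w =
        (\<Sum>k\<in>UNIV. snd w $ k * spray_derivative G (Dy k L) w) - 2 * (\<Sum>k\<in>UNIV. G w $ k * Dy k L w)"
      by (rule spray_derivative_eqI) (simp add: spray_derivative_def sum.distrib sum_subtractf sum_distrib_left mult_ac)
    also have "(\<Sum>k\<in>UNIV. snd w $ k * spray_derivative G (Dy k L) w) =
        (\<Sum>l\<in>UNIV. (\<Sum>k\<in>UNIV. snd w $ k * ?N w l k) * Dy l L w)"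
      unfolding SLi[OF w] sum_distrib_left sum_distrib_right by (subst sum.swap) (simp add: mult_ac)
    also have "\<dots> = 2 * (\<Sum>k\<in>UNIV. G w $ k * Dy k L w)" by (simp add: EG[OF w] sum_distrib_left mult_ac)
    finally have "spray_derivative G (\<lambda>w. 2 * L w) w = 0" by simp
    moreover have "spray_derivative G (\<lambda>w. 2 * L w) w = 2 * spray_derivative G L w"
      by (rule spray_derivative_eqI[OF has_derivative_mult_right[OF smooth_on_has_derivative[OF sm(1) w]]])
        (simp add: spray_derivative_def)
    ultimately show ?thesis by simp
  qed
  have "Dy i (spray_derivative G L) z = 0"
    by (rule Dy_eqI[OF has_derivative_transform_within_open[OF has_derivative_const[of 0] assms(1) z]])
      (simp_all add: SL)
  then show ?thesis
    using Dy_spray_derivative[OF assms(1,2,3) z, of i] SLi[OF z, of i] by simp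
qed

text \<open>
  The coefficients enter \<open>S(L\<^sub>i)\<close> only through the term \<open>- 2 G\<^sup>k L\<^sub>k\<^sub>i = - 4 g\<^sub>i\<^sub>k G\<^sup>k\<close>, and \<open>g\<close> is invertible.
\<close>

lemma euler_lagrange_determines_coefficients:
  assumes "open U" "smooth_on U L" "z \<in> U"
    and "det (\<chi> i j. 1/2 * Dy i (Dy j L) z) \<noteq> 0"
    and "\<And>i. spray_derivative G (Dy i L) z = spray_derivative H (Dy i L) z"
  shows "G z = H z"
proof -
  let ?g = "\<chi> i j. 1/2 * Dy i (Dy j L) z"
  have "(\<Sum>k\<in>UNIV. G z $ k * Dy k (Dy i L) z) = (\<Sum>k\<in>UNIV. H z $ k * Dy k (Dy i L) z)" for i
    using assms(5)[of i] by (simp add: spray_derivative_eq_sum[OF smooth_on_Dy[OF assms(2)] assms(3)])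
  then have "?g *v (G z - H z) = 0"
    using Dy_Dy_commute[OF assms(1-3)]
    by (simp add: vec_eq_iff matrix_vector_mult_def algebra_simps sum_subtractf sum_divide_distrib[symmetric])
  moreover have "invertible ?g" using assms(4) by (simp add: invertible_det_nz)
  ultimately have "G z - H z = 0" using matrix_left_invertible_ker[of ?g] unfolding invertible_def by blast
  then show ?thesis by simp
qed


section \<open>The slit tangent bundle in charts\<close>

lemma linear_frechet_derivative_transition:
  assumes "smooth_atlas A" "c \<in> A" "d \<in> A" "p \<in> fst c" "p \<in> fst d"
  shows "linear (frechet_derivative (transition c d) (at (snd c p)))"
proof -
  have "smooth_on (snd c ` (fst c \<inter> fst d)) (transition c d)"
    using assms(1-3) unfolding smooth_atlas_def by blast
  from smooth_on_has_derivative[OF this, of "snd c p"] show ?thesis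
    using assms(4,5) by (intro has_derivative_linear) auto
qed

lemma tangent_scale_slit_tangent_bundle:
  assumes A: "smooth_atlas A" and u: "u \<in> slit_tangent_bundle A" and t: "t > 0"
  shows "tangent_scale t u \<in> slit_tangent_bundle A"
proof -
  obtain p v where [simp]: "u = (p, v)" by (cases u)
  have pv: "p \<in> points A" "v \<in> tangent_space A p" "v \<noteq> (\<lambda>_. 0)"
    using u by (auto simp: slit_tangent_bundle_def tangent_bundle_def)
  have "t *\<^sub>R v d = frechet_derivative (transition c d) (at (snd c p)) (t *\<^sub>R v c)"
    if "c \<in> A" "d \<in> A" "p \<in> fst c" "p \<in> fst d" for c d
  proof -
    have "v d = frechet_derivative (transition c d) (at (snd c p)) (v c)"
      using pv(2) that unfolding tangent_space_def by blast
    then show ?thesis using linear_cmul[OF linear_frechet_derivative_transition[OF A that]] by simp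
  qed
  moreover have "t *\<^sub>R v c = 0" if "c \<notin> A \<or> p \<notin> fst c" for c
  proof -
    have "v c = 0" using pv(2) that unfolding tangent_space_def by blast
    then show ?thesis by simp
  qed
  ultimately have "(\<lambda>c. t *\<^sub>R v c) \<in> tangent_space A p"
    unfolding tangent_space_def mem_Collect_eq by blast
  moreover have "(\<lambda>c. t *\<^sub>R v c) \<noteq> (\<lambda>_. 0)" using pv(3) t by (simp add: fun_eq_iff)
  ultimately show ?thesis using pv(1)
    by (simp add: slit_tangent_bundle_def tangent_bundle_def tangent_scale_def)
qed

text \<open>
  A tangent vector is a family of components over all charts, but the transformation law
  determines every component from the one in \<open>c\<close>, and components at irrelevant indices are \<open>0\<close>.
\<close>

lemma inj_on_induced_coords:
  assumes A: "smooth_atlas A" and c: "c \<in> A"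
  shows "inj_on (snd (slit_chart A c)) (fst (slit_chart A c))"
proof (rule inj_onI)
  fix u u' assume "u \<in> fst (slit_chart A c)" "u' \<in> fst (slit_chart A c)"
    and eq: "snd (slit_chart A c) u = snd (slit_chart A c) u'"
  then have u: "snd u \<in> tangent_space A (fst u)" "snd u' \<in> tangent_space A (fst u')"
      "fst u \<in> fst c" "fst u' \<in> fst c"
    by (auto simp: slit_chart_def slit_tangent_bundle_def tangent_bundle_def)
  have eq': "snd c (fst u) = snd c (fst u')" "snd u c = snd u' c"
    using eq by (auto simp: slit_chart_def induced_coords_def)
  have p: "fst u = fst u'"
    using inj_onD[OF _ eq'(1) u(3,4)] A c by (auto simp: smooth_atlas_def)
  have "snd u d = snd u' d" for d
  proof (cases "d \<in> A \<and> fst u \<in> fst d")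
    case True
    have "v d = frechet_derivative (transition c d) (at (snd c (fst u))) (v c)"
      if "v \<in> tangent_space A (fst u)" for v
      using that True c u(3) unfolding tangent_space_def by blast
    then show ?thesis using u(1,2) p eq'(2) by metis
  next
    case False
    then have "v d = 0" if "v \<in> tangent_space A (fst u)" for v
      using that unfolding tangent_space_def by blast
    then show ?thesis using u(1,2) p by metis
  qed
  then show "u = u'" using p by (simp add: prod_eq_iff fun_eq_iff)
qed

lemma local_rep_slit_chart:
  assumes "smooth_atlas A" "c \<in> A" "u \<in> fst (slit_chart A c)"
  shows "local_rep (slit_chart A c) f (induced_coords c u) = f u"
  using chart_inv_snd[OF inj_on_induced_coords[OF assms(1,2)] assms(3)]
  by (simp add: local_rep_def slit_chart_def)

lemma chart_image_slit_chartE: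
  assumes "z \<in> chart_image (slit_chart A c)"
  obtains u where "u \<in> fst (slit_chart A c)" "z = induced_coords c u"
  using assms by (auto simp: chart_image_def slit_chart_def)

lemma open_chart_image_slit_chart:
  "smooth_atlas A \<Longrightarrow> c \<in> A \<Longrightarrow> open (chart_image (slit_chart A c))"
  by (auto simp: chart_image_slit_chart smooth_atlas_def intro!: open_Times)

lemma scale_chart_image_slit_chart:
  "smooth_atlas A \<Longrightarrow> c \<in> A \<Longrightarrow> (x, y) \<in> chart_image (slit_chart A c) \<Longrightarrow> t > 0 \<Longrightarrow>
    (x, t *\<^sub>R y) \<in> chart_image (slit_chart A c)"
  by (simp add: chart_image_slit_chart)

lemma local_square_smooth:
  assumes A: "smooth_atlas A" and c: "c \<in> A" and F: "finsler_structure A F"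
  shows "smooth_on (chart_image (slit_chart A c)) (local_square A F c)"
proof -
  have "smooth_on (chart_image (slit_chart A c)) (local_rep (slit_chart A c) F)"
    using F c by (simp add: finsler_structure_def smooth_function_def slit_atlas_def)
  from smooth_on_mult[OF open_chart_image_slit_chart[OF A c] this this] show ?thesis
    by (simp add: local_square_def local_rep_def o_def power2_eq_square)
qed

text \<open>
  In induced coordinates, \<open>tangent_scale t\<close> is \<open>(x, y) \<mapsto> (x, t y)\<close>.
\<close>

lemma local_square_homogeneous:
  assumes A: "smooth_atlas A" and c: "c \<in> A" and F: "finsler_structure A F"
    and z: "(x, y) \<in> chart_image (slit_chart A c)" and t: "t > 0"
  shows "local_square A F c (x, t *\<^sub>R y) = t\<^sup>2 * local_square A F c (x, y)"
proof -
  obtain u where u: "u \<in> fst (slit_chart A c)" and xy: "(x, y) = induced_coords c u"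
    using z by (rule chart_image_slit_chartE)
  have su: "tangent_scale t u \<in> fst (slit_chart A c)"
    using tangent_scale_slit_tangent_bundle[OF A _ t, of u] u
    by (simp add: slit_chart_def tangent_scale_def)
  have "(x, t *\<^sub>R y) = induced_coords c (tangent_scale t u)"
    using xy by (simp add: induced_coords_def tangent_scale_def)
  then have "local_square A F c (x, t *\<^sub>R y) = (F (tangent_scale t u))\<^sup>2"
    using local_rep_slit_chart[OF A c su] by (simp add: local_square_def)
  moreover have "F (tangent_scale t u) = t * F u"
    using F t u by (simp add: finsler_structure_def slit_chart_def slit_tangent_bundle_def)
  moreover have "local_square A F c (x, y) = (F u)\<^sup>2"
    using local_rep_slit_chart[OF A c u] xy by (simp add: local_square_def)
  ultimately show ?thesis by (simp add: power_mult_distrib)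
qed

lemma local_square_euler:
  assumes A: "smooth_atlas A" and c: "c \<in> A" and F: "finsler_structure A F"
    and z: "z \<in> chart_image (slit_chart A c)"
  shows "(\<Sum>k\<in>UNIV. snd z $ k * Dy k (local_square A F c) z) = 2 * local_square A F c z"
proof -
  obtain x y where xy: "z = (x, y)" by (cases z)
  have "local_square A F c differentiable (at (x, y))"
    using smooth_on_has_derivative[OF local_square_smooth[OF A c F] z] xy
    by (auto intro: differentiableI)
  from euler_homogeneous[OF this, of 2] show ?thesis
    using local_square_homogeneous[OF A c F] z xy by simp
qed

text \<open>
  The definition of a spray provides some coefficient function \<open>G\<close> in the chart. On the image of
  the chart it coincides with \<open>spray_coeff\<close>, which thereby inherits smoothness and homogeneity.
\<close>

lemma spray_in_chart:
  assumes A: "smooth_atlas A" and c: "c \<in> A" and S: "is_spray A S"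
  shows "smooth_on (chart_image (slit_chart A c)) (spray_coeff A S c)"
    and "(x, y) \<in> chart_image (slit_chart A c) \<Longrightarrow> t > 0 \<Longrightarrow>
      spray_coeff A S c (x, t *\<^sub>R y) = t\<^sup>2 *\<^sub>R spray_coeff A S c (x, y)"
    and "z \<in> chart_image (slit_chart A c) \<Longrightarrow>
      local_rep (slit_chart A c) (\<lambda>u. S u (slit_chart A c)) z = (snd z, - 2 *\<^sub>R spray_coeff A S c z)"
proof -
  obtain G where G: "smooth_on (chart_image (slit_chart A c)) G"
    "\<And>x y t. (x, y) \<in> chart_image (slit_chart A c) \<Longrightarrow> t > 0 \<Longrightarrow> G (x, t *\<^sub>R y) = t\<^sup>2 *\<^sub>R G (x, y)"
    "\<And>u. u \<in> fst (slit_chart A c) \<Longrightarrow>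
      S u (slit_chart A c) = (snd (induced_coords c u), - 2 *\<^sub>R G (induced_coords c u))"
    using S c unfolding is_spray_def by blast
  have loc: "local_rep (slit_chart A c) (\<lambda>u. S u (slit_chart A c)) z = (snd z, - 2 *\<^sub>R G z)"
    if "z \<in> chart_image (slit_chart A c)" for z
    using that by (rule chart_image_slit_chartE) (simp add: local_rep_slit_chart[OF A c] G(3))
  then have eq: "spray_coeff A S c z = G z" if "z \<in> chart_image (slit_chart A c)" for z
    using that by (simp add: spray_coeff_def)
  show "smooth_on (chart_image (slit_chart A c)) (spray_coeff A S c)"
    by (rule smooth_on_cong[OF open_chart_image_slit_chart[OF A c] _ G(1)]) (simp add: eq)
  show "(x, y) \<in> chart_image (slit_chart A c) \<Longrightarrow> t > 0 \<Longrightarrow>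
      spray_coeff A S c (x, t *\<^sub>R y) = t\<^sup>2 *\<^sub>R spray_coeff A S c (x, y)"
    using scale_chart_image_slit_chart[OF A c] by (simp add: eq G(2))
  show "z \<in> chart_image (slit_chart A c) \<Longrightarrow>
      local_rep (slit_chart A c) (\<lambda>u. S u (slit_chart A c)) z = (snd z, - 2 *\<^sub>R spray_coeff A S c z)"
    by (simp add: eq loc)
qed

lemma vf_apply_spray:
  assumes "smooth_atlas A" "c \<in> A" "is_spray A S" "z \<in> chart_image (slit_chart A c)"
  shows "vf_apply (slit_chart A c) S f z = spray_derivative (spray_coeff A S c) f z"
  by (simp add: vf_apply_def spray_derivative_def spray_in_chart(3)[OF assms])

lemma spray_coeff_euler:
  assumes A: "smooth_atlas A" and c: "c \<in> A" and S: "is_spray A S"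
    and z: "z \<in> chart_image (slit_chart A c)"
  shows "(\<Sum>i\<in>UNIV. snd z $ i * Dy i (\<lambda>w. spray_coeff A S c w $ k) z) = 2 * spray_coeff A S c z $ k"
proof -
  obtain x y where xy: "z = (x, y)" by (cases z)
  have "(\<lambda>w. spray_coeff A S c w $ k) differentiable (at (x, y))"
    using smooth_on_component_has_derivative[OF spray_in_chart(1)[OF A c S] z] xy
    by (auto intro: differentiableI)
  from euler_homogeneous[OF this, of 2] show ?thesis
    using spray_in_chart(2)[OF A c S] z xy by simp
qed

lemma dynamical_derivative_metric_tensor:
  assumes "smooth_atlas A" "c \<in> A" "is_spray A S" "z \<in> chart_image (slit_chart A c)"
  shows "dynamical_derivative A S c (metric_tensor A F c) i j z =
    metric_derivative (spray_coeff A S c) (local_square A F c) i j z"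
  by (simp add: dynamical_derivative_def metric_derivative_def vf_apply_spray[OF assms]
      metric_tensor_def nonlinear_connection_def)

lemma euler_lagrange_iff:
  assumes "smooth_atlas A" "is_spray A S"
  shows "euler_lagrange A F S \<longleftrightarrow>
    (\<forall>c\<in>A. \<forall>z\<in>chart_image (slit_chart A c). \<forall>i.
      spray_derivative (spray_coeff A S c) (Dy i (local_square A F c)) z = Dx i (local_square A F c) z)"
  using vf_apply_spray[OF assms(1) _ assms(2)] by (auto simp: euler_lagrange_def)

text \<open>
  A value \<open>S u\<close> is itself a family of components over the charts of the slit tangent bundle. In a
  chart around \<open>u\<close> the component is \<open>(y, - 2 G)\<close>, where \<open>G\<close> is determined by the Euler--Lagrange
  equation; at all other indices it is \<open>0\<close>.
\<close>

lemma euler_lagrange_spray_unique: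
  assumes A: "smooth_atlas A" and F: "finsler_structure A F"
    and S: "is_spray A S" "euler_lagrange A F S" and S': "is_spray A S'" "euler_lagrange A F S'"
    and u: "u \<in> slit_tangent_bundle A"
  shows "S' u = S u"
proof
  fix d
  obtain c where "c \<in> A" "fst u \<in> fst c"
    using u by (auto simp: slit_tangent_bundle_def tangent_bundle_def points_def)
  then have "u \<in> points (slit_atlas A)"
    using u by (auto simp: points_def slit_atlas_def slit_chart_def)
  then have tan: "S u \<in> tangent_space (slit_atlas A) u" "S' u \<in> tangent_space (slit_atlas A) u"
    using S(1) S'(1) by (simp_all add: is_spray_def smooth_vector_field_def)
  show "S' u d = S u d"
  proof (cases "d \<in> slit_atlas A \<and> u \<in> fst d")
    case False
    then have "v d = 0" if "v \<in> tangent_space (slit_atlas A) u" for v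
      using that unfolding tangent_space_def by blast
    from this[OF tan(1)] this[OF tan(2)] show ?thesis by simp
  next
    case True
    then obtain c where c: "c \<in> A" and d: "d = slit_chart A c" and uc: "u \<in> fst (slit_chart A c)"
      by (auto simp: slit_atlas_def)
    let ?z = "induced_coords c u"
    have z: "?z \<in> chart_image (slit_chart A c)"
      using uc by (auto simp: chart_image_def slit_chart_def)
    have "det (metric_tensor A F c ?z) \<noteq> 0" using F c z by (simp add: finsler_structure_def)
    then have "spray_coeff A S' c ?z = spray_coeff A S c ?z"
      using S S' c z
      by (intro euler_lagrange_determines_coefficients[OF open_chart_image_slit_chart[OF A c]
            local_square_smooth[OF A c F] z])
        (simp_all add: euler_lagrange_iff[OF A] metric_tensor_def)
    then show ?thesis
      using spray_in_chart(3)[OF A c S(1) z] spray_in_chart(3)[OF A c S'(1) z]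
      by (simp add: local_rep_slit_chart[OF A c uc] d)
  qed
qed

theorem theorem1p1:
  fixes A :: "('m, real^'n::finite) chart set"
    and F :: "('m, real^'n) tvec \<Rightarrow> real"
    and S :: "('m, real^'n) tvec \<Rightarrow>
                (('m, real^'n) tvec, (real^'n) \<times> (real^'n)) chart \<Rightarrow> (real^'n) \<times> (real^'n)"
  assumes "smooth_manifold A"
    and "connected_space (manifold_topology A)"
    and "is_spray A S"
    and "finsler_structure A F"
  shows "is_geodesic_spray A F S \<longleftrightarrow>
    (\<forall>c\<in>A. \<forall>z\<in>chart_image (slit_chart A c). \<forall>i j.
       dynamical_derivative A S c (metric_tensor A F c) i j z = 0)"
proof -
  note S = assms(3) and F = assms(4)
  have A: "smooth_atlas A" using assms(1) by (simp add: smooth_manifold_def)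
  have "is_geodesic_spray A F S \<longleftrightarrow> euler_lagrange A F S"
    using euler_lagrange_spray_unique[OF A F S] S unfolding is_geodesic_spray_def by blast
  also have "\<dots> \<longleftrightarrow> (\<forall>c\<in>A. \<forall>z\<in>chart_image (slit_chart A c). \<forall>i j.
       metric_derivative (spray_coeff A S c) (local_square A F c) i j z = 0)"
    unfolding euler_lagrange_iff[OF A S]
  proof (rule ball_cong[OF refl])
    fix c assume c: "c \<in> A"
    let ?U = "chart_image (slit_chart A c)"
    note chart = open_chart_image_slit_chart[OF A c] local_square_smooth[OF A c F]
      spray_in_chart(1)[OF A c S]
    show "(\<forall>z\<in>?U. \<forall>i. spray_derivative (spray_coeff A S c) (Dy i (local_square A F c)) z
          = Dx i (local_square A F c) z) \<longleftrightarrow>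
        (\<forall>z\<in>?U. \<forall>i j. metric_derivative (spray_coeff A S c) (local_square A F c) i j z = 0)"
      using metric_derivative_zero_if_euler_lagrange[OF chart]
        euler_lagrange_if_metric_derivative_zero[OF chart local_square_euler[OF A c F]
          spray_coeff_euler[OF A c S]]
      by blast
  qed
  also have "\<dots> \<longleftrightarrow> (\<forall>c\<in>A. \<forall>z\<in>chart_image (slit_chart A c). \<forall>i j.
       dynamical_derivative A S c (metric_tensor A F c) i j z = 0)"
    by (simp add: dynamical_derivative_metric_tensor[OF A _ S])
  finally show ?thesis .
qed

end
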